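(* Let $G$ be a finite group and for $g\in G$ let $c_G(g):=\sum_{H\leq G,\ g\in H}\frac{1}{|H|}$. Then $c_G(g)$ depends only on the cyclic subgroup $\langle g\rangle$. In particular, if $g,k\in G$ satisfy $\langle g\rangle=\langle k\rangle$, then $c_G(g)=c_G(k)$.
   Context: The sum defining $c_G(g)$ ranges over all subgroups $H$ of $G$ containing $g$. $\langle g\rangle$ denotes the cyclic subgroup generated by $g$. *)

theory Defs
  imports Complex_Main "HOL-Algebra.Generated_Groups"
begin

definition subgroup_sum :: "('a, 'b) monoid_scheme \<Rightarrow> 'a \<Rightarrow> real" where
  "subgroup_sum G g = (\<Sum>H | subgroup H G \<and> g \<in> H. 1 / real (card H))"

end

theory Submission
  imports Defs
begin

text \<open>A subgroup contains an element \<open>g\<close> exactly when it contains the cyclic subgroup generated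
  by \<open>g\<close>. Hence the index set of the sum attached to \<open>g\<close> is the set of all subgroups above
  \<open>\<langle>g\<rangle>\<close>, and the required function of cyclic subgroups sends any set \<open>C\<close> to the sum of the
  reciprocal orders of the subgroups containing \<open>C\<close>.\<close>

lemma (in group) generate_singleton_subset_iff:
  assumes "subgroup H G"
  shows "generate G {g} \<subseteq> H \<longleftrightarrow> g \<in> H"
  using generate_subgroup_incl[OF _ assms, of "{g}"] generate.incl[of g "{g}" G] by blast

lemma (in group) subgroup_sum_eq_sum_over_generate:
  "subgroup_sum G g = (\<Sum>H | subgroup H G \<and> generate G {g} \<subseteq> H. 1 / real (card H))"
  unfolding subgroup_sum_def
  by (simp add: generate_singleton_subset_iff cong: conj_cong)

theorem proposition3p4:
  fixes G :: "('a, 'b) monoid_scheme"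
  assumes "group G" and "finite (carrier G)"
  shows "(\<exists>f :: 'a set \<Rightarrow> real. \<forall>g \<in> carrier G. subgroup_sum G g = f (generate G {g})) \<and>
    (\<forall>g \<in> carrier G. \<forall>k \<in> carrier G.
       generate G {g} = generate G {k} \<longrightarrow> subgroup_sum G g = subgroup_sum G k)"
proof -
  define f :: "'a set \<Rightarrow> real" where
    "f C = (\<Sum>H | subgroup H G \<and> C \<subseteq> H. 1 / real (card H))" for C
  have "subgroup_sum G g = f (generate G {g})" for g
    unfolding f_def by (rule group.subgroup_sum_eq_sum_over_generate[OF assms(1)])
  then show ?thesis
    by auto
qed

end
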